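(* Let $d\geq 1$ and let $\rho,\sigma$ be $d\times d$ density matrices. Then \[ \max_{U\in \mathcal{U}(d)} F(\rho, U\sigma U^\dagger) = F\big(\lambda^\downarrow(\rho),\lambda^\downarrow(\sigma)\big)=\sum_{j=1}^d\sqrt{\lambda^\downarrow_j(\rho)\lambda^\downarrow_j(\sigma)}, \] \[ \min_{U\in \mathcal{U}(d)} F(\rho, U\sigma U^\dagger) = F\big(\lambda^\downarrow(\rho),\lambda^\uparrow(\sigma)\big)=\sum_{j=1}^d\sqrt{\lambda^\downarrow_j(\rho)\lambda^\uparrow_j(\sigma)}. \]
   Context: A density matrix is a positive semidefinite complex matrix of trace one. $\mathcal{U}(d)$ denotes the group of $d\times d$ unitary matrices. The (quantum) fidelity of density matrices $\rho,\sigma$ is $F(\rho,\sigma)=\operatorname{Tr}\sqrt{\sqrt{\rho}\,\sigma\sqrt{\rho}}$. For probability vectors $p=(p_j),q=(q_j)$ the classical fidelity is $F(p,q)=\sum_j\sqrt{p_jq_j}$. For a Hermitian matrix $A$, $\lambda^\downarrow(A)=(\lambda^\downarrow_1(A),\dots,\lambda^\downarrow_d(A))$ is the vector of its eigenvalues (with multiplicity) listed in decreasing order and $\lambda^\uparrow(A)$ the same eigenvalues listed in increasing order. *)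

theory Defs
  imports "Jordan_Normal_Form.Schur_Decomposition" "Jordan_Normal_Form.Char_Poly"
begin

definition hermitian_mat :: "nat \<Rightarrow> complex mat \<Rightarrow> bool" where
  "hermitian_mat n A \<longleftrightarrow> A \<in> carrier_mat n n \<and> mat_adjoint A = A"

definition psd_mat :: "nat \<Rightarrow> complex mat \<Rightarrow> bool" where
  "psd_mat n A \<longleftrightarrow> hermitian_mat n A \<and>
     (\<forall>v \<in> carrier_vec n. 0 \<le> Re (\<Sum>i<n. cnj (vec_index v i) * vec_index (A *\<^sub>v v) i))"

definition mat_trace :: "complex mat \<Rightarrow> complex" where
  "mat_trace A = (\<Sum>i<dim_row A. A $$ (i, i))"

definition density_mat :: "nat \<Rightarrow> complex mat \<Rightarrow> bool" where
  "density_mat n A \<longleftrightarrow> psd_mat n A \<and> mat_trace A = 1"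

definition unitary_mat :: "nat \<Rightarrow> complex mat \<Rightarrow> bool" where
  "unitary_mat n U \<longleftrightarrow> U \<in> carrier_mat n n \<and> U * mat_adjoint U = 1\<^sub>m n"

definition mat_sqrt :: "complex mat \<Rightarrow> complex mat" where
  "mat_sqrt A = (THE B. psd_mat (dim_row A) B \<and> B * B = A)"

definition fidelity :: "complex mat \<Rightarrow> complex mat \<Rightarrow> real" where
  "fidelity \<rho> \<sigma> = Re (mat_trace (mat_sqrt (mat_sqrt \<rho> * \<sigma> * mat_sqrt \<rho>)))"

definition eig_desc :: "complex mat \<Rightarrow> real list" where
  "eig_desc A = (THE es. length es = dim_row A \<and> sorted_wrt (\<ge>) es \<and>
       char_poly A = (\<Prod>e\<leftarrow>es. [:- complex_of_real e, 1:]))"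

definition eig_asc :: "complex mat \<Rightarrow> real list" where
  "eig_asc A = rev (eig_desc A)"

definition classical_fidelity :: "real list \<Rightarrow> real list \<Rightarrow> real" where
  "classical_fidelity p q = (\<Sum>j<length p. sqrt (p ! j * q ! j))"

end

(* Write rho = P diag(a) P*, U sigma U* = Q diag(b) Q*, and C = sqrt(U sigma U* ) sqrt(rho), so that
   the fidelity is the sum of the singular values of C. With the unitary X = Q* P:

   Lower bound: the singular values dominate Tr C = sum_ij sqrt(a_i) sqrt(b_j) |X_ji|^2, and the
   weights |X_ji|^2 are doubly stochastic, so a rearrangement inequality applies.

   Upper bound: the sum of the singular values equals Tr (V C) for a partial isometry V. With
   Z = P* V Q this is sum_ij sqrt(a_i) sqrt(b_j) Z_ij X_ji, and by AM-GM the terms are bounded with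
   the doubly substochastic weights (|Z_ij|^2 + |X_ji|^2) / 2.

   Both bounds are attained by the unitary that aligns the two eigenbases, with the eigenvalues of
   sigma listed in the appropriate order. *)

theory Submission
  imports Defs "HOL-Analysis.L2_Norm"
begin

section \<open>Adjoints, unitary and positive semidefinite matrices\<close>

text \<open>Both \<open>mat_sqrt\<close> and \<open>eig_desc\<close> are definite descriptions, so
  uniqueness of the positive root and of the sorted factorisation must be settled before either can
  be computed. After that, every matrix in sight has the shape
  \<open>U * rdiag n f * mat_adjoint U\<close> and is handled through \<open>f\<close>. The obstacle
  in the upper bound is that C may be singular, so that C fixes its left singular vectors only in
  part. A pseudo-inverse yields a partial isometry instead of a unitary; its row and column sums of
  squared moduli are at most one, which suffices because the square roots of the eigenvalues are
  nonnegative. AM-GM separates Z from X, so that the sums of each can be bounded on their own. The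
  rearrangement inequality uses Abel summation rather than a decomposition into permutations: only
  sums over upper left corners of the weight matrix have to be compared, and the identity matrix
  maximises all of them at once.\<close>

lemma mat_adjoint_dim [simp]:
  "dim_row (mat_adjoint A) = dim_col A" "dim_col (mat_adjoint A) = dim_row A"
  by (simp_all add: mat_adjoint_def)

lemma mat_adjoint_carrier [simp, intro]:
  "A \<in> carrier_mat n m \<Longrightarrow> mat_adjoint A \<in> carrier_mat m n"
  by (intro carrier_matI) auto

lemma mat_adjoint_index [simp]:
  fixes A :: "complex mat"
  assumes "i < dim_col A" "j < dim_row A"
  shows "mat_adjoint A $$ (i, j) = cnj (A $$ (j, i))"
  using assms by (simp add: mat_adjoint_def mat_of_rows_index)

lemma mult_mat_index:
  fixes A B :: "complex mat"
  assumes "A \<in> carrier_mat n m" "B \<in> carrier_mat m k" "i < n" "j < k"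
  shows "(A * B) $$ (i, j) = (\<Sum>l<m. A $$ (i, l) * B $$ (l, j))"
  using assms by (auto simp: scalar_prod_def atLeast0LessThan)

lemma mat_adjoint_mult:
  fixes A B :: "complex mat"
  assumes "A \<in> carrier_mat n m" "B \<in> carrier_mat m k"
  shows "mat_adjoint (A * B) = mat_adjoint B * mat_adjoint A"
proof (rule eq_matI)
  fix i j assume "i < dim_row (mat_adjoint B * mat_adjoint A)"
    and "j < dim_col (mat_adjoint B * mat_adjoint A)"
  then have ij: "i < k" "j < n" using assms by auto
  have "mat_adjoint (A * B) $$ (i, j) = cnj ((A * B) $$ (j, i))"
    using ij assms by (intro mat_adjoint_index) auto
  also have "\<dots> = (\<Sum>l<m. mat_adjoint B $$ (i, l) * mat_adjoint A $$ (l, j))"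
    using ij assms by (subst mult_mat_index[OF assms]) (auto simp: mult.commute intro!: sum.cong)
  also have "\<dots> = (mat_adjoint B * mat_adjoint A) $$ (i, j)"
    using ij assms by (intro mult_mat_index[symmetric, where n = k and k = n]) auto
  finally show "mat_adjoint (A * B) $$ (i, j) = (mat_adjoint B * mat_adjoint A) $$ (i, j)" .
qed (use assms in auto)

lemma mat_adjoint_adjoint [simp]:
  fixes A :: "complex mat"
  shows "mat_adjoint (mat_adjoint A) = A"
  by (rule eq_matI) auto

text \<open>Spectra are kept as real functions, so self-adjointness is automatic and products and
  square roots act pointwise on \<open>f\<close>.\<close>

definition rdiag :: "nat \<Rightarrow> (nat \<Rightarrow> real) \<Rightarrow> complex mat" where
  "rdiag n f = mat_diag n (\<lambda>i. complex_of_real (f i))"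

lemma mat_adjoint_rdiag [simp]: "mat_adjoint (rdiag n f) = rdiag n f"
  by (rule eq_matI) (auto simp: rdiag_def mat_diag_def)

lemma rdiag_carrier [simp]: "rdiag n f \<in> carrier_mat n n"
  by (simp add: rdiag_def)

lemma rdiag_dim [simp]: "dim_row (rdiag n f) = n" "dim_col (rdiag n f) = n"
  using rdiag_carrier[of n f] by (auto simp del: rdiag_carrier)

lemma rdiag_mult [simp]: "rdiag n f * rdiag n g = rdiag n (\<lambda>i. f i * g i)"
  by (simp add: rdiag_def)

text \<open>Matrix products are normalised to the right, so two neighbouring diagonal factors meet
  in this nested form; \<open>unitary_mat_cancel\<close> has the same shape for the same
  reason.\<close>

lemma rdiag_mult_assoc [simp]:
  assumes "X \<in> carrier_mat n n"
  shows "rdiag n f * (rdiag n g * X) = rdiag n (\<lambda>i. f i * g i) * X"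
  using assms by (simp flip: assoc_mult_mat[of _ n n _ n _ n])

lemma rdiag_cong: "(\<And>i. i < n \<Longrightarrow> f i = g i) \<Longrightarrow> rdiag n f = rdiag n g"
  by (intro eq_matI) (auto simp: rdiag_def mat_diag_def)

lemma rdiag_index: "i < n \<Longrightarrow> j < n \<Longrightarrow> rdiag n f $$ (i, j) = (if i = j then complex_of_real (f i) else 0)"
  by (simp add: rdiag_def mat_diag_def)

lemma rdiag_mult_index:
  assumes "A \<in> carrier_mat n n" "i < n" "j < n"
  shows "(rdiag n f * A) $$ (i, j) = complex_of_real (f i) * A $$ (i, j)"
    and "(A * rdiag n f) $$ (i, j) = A $$ (i, j) * complex_of_real (f j)"
  using assms by (simp_all add: rdiag_def mat_diag_mult_left mat_diag_mult_right)

lemma mat_trace_eq: "A \<in> carrier_mat n n \<Longrightarrow> mat_trace A = (\<Sum>i<n. A $$ (i, i))"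
  by (auto simp: mat_trace_def)

lemma mat_trace_comm:
  assumes "A \<in> carrier_mat n m" "B \<in> carrier_mat m n"
  shows "mat_trace (A * B) = mat_trace (B * A)"
proof -
  have "mat_trace (A * B) = (\<Sum>i<n. \<Sum>l<m. A $$ (i, l) * B $$ (l, i))"
    using assms by (simp add: mat_trace_eq[of _ n] mult_mat_index[OF assms] del: index_mult_mat)
  also have "\<dots> = (\<Sum>l<m. \<Sum>i<n. B $$ (l, i) * A $$ (i, l))"
    by (subst sum.swap) (simp add: mult.commute)
  also have "\<dots> = mat_trace (B * A)"
    using assms by (simp add: mat_trace_eq[of _ m] mult_mat_index[OF assms(2,1)] del: index_mult_mat)
  finally show ?thesis .
qed

text \<open>Turns matrix identities such as unitarity into statements about sums of squared moduli,
  the source of all the weights below.\<close>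

lemma gram_diag:
  fixes A :: "complex mat"
  assumes "A \<in> carrier_mat n m" "i < n"
  shows "(A * mat_adjoint A) $$ (i, i) = complex_of_real (\<Sum>j<m. (cmod (A $$ (i, j)))\<^sup>2)"
  using assms by (subst mult_mat_index[of _ n m _ n]) (auto simp: complex_norm_square simp del: of_real_power intro!: sum.cong)

lemma unitary_matD:
  assumes "unitary_mat n U"
  shows "U \<in> carrier_mat n n" "U * mat_adjoint U = 1\<^sub>m n" "mat_adjoint U * U = 1\<^sub>m n"
proof -
  show U: "U \<in> carrier_mat n n" and UU: "U * mat_adjoint U = 1\<^sub>m n"
    using assms by (auto simp: unitary_mat_def)
  show "mat_adjoint U * U = 1\<^sub>m n"
    by (rule mat_mult_left_right_inverse[OF U _ UU]) (use U in auto)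
qed

lemma unitary_mat_cancel:
  assumes "unitary_mat n U" "X \<in> carrier_mat n n"
  shows "U * (mat_adjoint U * X) = X" "mat_adjoint U * (U * X) = X"
  using unitary_matD[OF assms(1)] assms(2)
  by (simp_all flip: assoc_mult_mat[of _ n n _ n _ n])

lemma unitary_mat_adjoint:
  assumes "unitary_mat n U"
  shows "unitary_mat n (mat_adjoint U)"
  using unitary_matD[OF assms] by (simp add: unitary_mat_def)

lemma unitary_mat_mult:
  assumes "unitary_mat n U" "unitary_mat n V"
  shows "unitary_mat n (U * V)"
proof -
  note U = unitary_matD[OF assms(1)] and V = unitary_matD[OF assms(2)]
  have "U * V * mat_adjoint (U * V) = U * (V * (mat_adjoint V * mat_adjoint U))"
    using U(1) V(1) by (simp add: mat_adjoint_mult[OF U(1) V(1)] assoc_mult_mat[of _ n n _ n _ n] mult_carrier_mat[of _ n n])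
  then show ?thesis
    using U V by (simp add: unitary_mat_def unitary_mat_cancel[OF assms(2)])
qed

text \<open>The quadratic form at \<open>v\<close> is the squared norm of
  \<open>K *\<^sub>v v\<close>.\<close>

lemma psd_mat_gram:
  assumes K: "K \<in> carrier_mat m n"
  shows "psd_mat n (mat_adjoint K * K)"
proof -
  have "(\<Sum>i<n. cnj (v $ i) * ((mat_adjoint K * K) *\<^sub>v v) $ i)
      = complex_of_real (\<Sum>k<m. (cmod ((K *\<^sub>v v) $ k))\<^sup>2)"
    if v: "v \<in> carrier_vec n" for v
  proof -
    have "((mat_adjoint K * K) *\<^sub>v v) $ i = (\<Sum>k<m. cnj (K $$ (k, i)) * (K *\<^sub>v v) $ k)"
      if "i < n" for i
      using K v that
      by (subst assoc_mult_mat_vec[of _ n m _ n])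
        (auto simp: scalar_prod_def atLeast0LessThan mult_mat_vec_def intro!: sum.cong)
    then have "(\<Sum>i<n. cnj (v $ i) * ((mat_adjoint K * K) *\<^sub>v v) $ i)
        = (\<Sum>k<m. \<Sum>i<n. cnj (v $ i) * (cnj (K $$ (k, i)) * (K *\<^sub>v v) $ k))"
      by (subst sum.swap) (simp add: sum_distrib_left)
    also have "\<dots> = (\<Sum>k<m. cnj ((K *\<^sub>v v) $ k) * (K *\<^sub>v v) $ k)"
    proof (rule sum.cong[OF refl])
      fix k assume "k \<in> {..<m}"
      then have "(K *\<^sub>v v) $ k = (\<Sum>i<n. K $$ (k, i) * v $ i)"
        using K v by (auto simp: scalar_prod_def atLeast0LessThan intro!: sum.cong)
      then have "cnj ((K *\<^sub>v v) $ k) = (\<Sum>i<n. cnj (v $ i) * cnj (K $$ (k, i)))"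
        by (simp add: mult.commute)
      then show "(\<Sum>i<n. cnj (v $ i) * (cnj (K $$ (k, i)) * (K *\<^sub>v v) $ k))
          = cnj ((K *\<^sub>v v) $ k) * (K *\<^sub>v v) $ k"
        by (simp add: sum_distrib_right mult.assoc)
    qed
    finally show ?thesis
      by (simp add: complex_norm_square mult.commute del: of_real_power)
  qed
  note form = this
  have herm: "hermitian_mat n (mat_adjoint K * K)"
    using K by (simp add: hermitian_mat_def mat_adjoint_mult[of _ n m _ n] mult_carrier_mat[of _ n m])
  have pos: "0 \<le> Re (\<Sum>i<n. cnj (v $ i) * ((mat_adjoint K * K) *\<^sub>v v) $ i)"
    if "v \<in> carrier_vec n" for v
    unfolding form[OF that] Re_complex_of_real by (rule sum_nonneg) simp
  show ?thesis
    unfolding psd_mat_def by (intro conjI ballI herm pos)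
qed

text \<open>The entry is the quadratic form of \<open>A\<close> at column \<open>k\<close> of
  \<open>Q\<close>. If \<open>Q\<close> diagonalises \<open>A\<close>, it is an eigenvalue.\<close>

lemma psd_mat_diagonal_nonneg:
  assumes "psd_mat n A" "Q \<in> carrier_mat n n" "k < n"
  shows "0 \<le> Re ((mat_adjoint Q * A * Q) $$ (k, k))"
proof -
  have A: "A \<in> carrier_mat n n"
    using assms by (auto simp: psd_mat_def hermitian_mat_def)
  have "(mat_adjoint Q * A * Q) $$ (k, k) = (mat_adjoint Q * (A * Q)) $$ (k, k)"
    using A assms by (simp add: assoc_mult_mat[of _ n n _ n _ n])
  also have "\<dots> = (\<Sum>i<n. cnj (col Q k $ i) * (A *\<^sub>v col Q k) $ i)"
    using A assms by (subst mult_mat_index[of _ n n _ n]) (auto intro!: sum.cong)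
  finally show ?thesis
    using assms unfolding psd_mat_def by (metis col_carrier_vec)
qed

lemma conj_rdiag_mult:
  assumes U: "unitary_mat n U"
  shows "(U * rdiag n f * mat_adjoint U) * (U * rdiag n g * mat_adjoint U)
    = U * rdiag n (\<lambda>i. f i * g i) * mat_adjoint U"
  using unitary_matD[OF U]
  by (simp add: assoc_mult_mat[of _ n n _ n _ n] mult_carrier_mat[of _ n n] unitary_mat_cancel[OF U])

lemma psd_mat_conj_rdiag:
  assumes U: "unitary_mat n U" and f: "\<And>i. i < n \<Longrightarrow> 0 \<le> f i"
  shows "psd_mat n (U * rdiag n f * mat_adjoint U)"
proof -
  define K where "K = rdiag n (\<lambda>i. sqrt (f i)) * mat_adjoint U"
  have "K \<in> carrier_mat n n"
    unfolding K_def using unitary_matD(1)[OF U] by (auto intro!: mult_carrier_mat[of _ n n])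
  moreover have "rdiag n (\<lambda>i. sqrt (f i) * sqrt (f i)) = rdiag n f"
    using f by (intro rdiag_cong) simp
  then have "mat_adjoint K * K = U * rdiag n f * mat_adjoint U"
    using unitary_matD[OF U]
    by (simp add: K_def mat_adjoint_mult[of _ n n _ n] assoc_mult_mat[of _ n n _ n _ n]
        mult_carrier_mat[of _ n n] del: real_sqrt_mult_self)
  ultimately show ?thesis
    using psd_mat_gram[of K n n] by simp
qed

section \<open>Spectral theorem and square roots\<close>

text \<open>Gram-Schmidt gives orthogonal columns that are not normalised, starting with
  \<open>v\<close> itself. Dividing each column by its norm makes the matrix unitary, and the factor
  \<open>c\<close> records what happens to \<open>v\<close>.\<close>

lemma unitary_mat_extend_vec:
  fixes v :: "complex vec"
  assumes v: "v \<in> carrier_vec n" and v0: "v \<noteq> 0\<^sub>v n"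
  shows "\<exists>W c. unitary_mat n W \<and> col W 0 = c \<cdot>\<^sub>v v"
proof -
  interpret cof_vec_space n "TYPE(complex)" .
  define ws where "ws = gram_schmidt n (basis_completion v)"
  note b = basis_completion[OF v v0]
  have n: "0 < n"
    using v v0 by (cases n) auto
  have len: "length ws = n" and ws: "set ws \<subseteq> carrier_vec n" and orth: "corthogonal ws"
    using gram_schmidt_result[OF b(2,4,5) refl] b(6) by (auto simp: ws_def)
  obtain vs where vs: "basis_completion v = v # vs"
    using b(6,7) n by (cases "basis_completion v") auto
  have hd: "ws ! 0 = v"
    using gram_schmidt_hd[OF v, of vs] len n by (cases ws) (auto simp: ws_def vs)
  define W where "W = mat_of_cols n ws"
  have W: "W \<in> carrier_mat n n" and W0: "col W 0 = v"
    using len n hd v by (auto simp: W_def)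
  \<comment> \<open>The norm of column \<open>i\<close> of \<open>W\<close>, written as a row norm
    of the adjoint to fit \<open>gram_diag\<close>.\<close>
  define s where "s i = sqrt (\<Sum>j<n. (cmod (mat_adjoint W $$ (i, j)))\<^sup>2)" for i
  have diag: "(mat_adjoint W * W) $$ (i, i) = complex_of_real (s i * s i)" if "i < n" for i
    using gram_diag[of "mat_adjoint W" n n i] W that by (simp add: s_def sum_nonneg)
  have "corthogonal_mat W"
    unfolding W_def by (rule orthogonal_mat_of_cols[OF ws orth len])
  then have off: "(mat_adjoint W * W) $$ (i, j) = 0 \<longleftrightarrow> i \<noteq> j" if "i < n" "j < n" for i j
    using that W unfolding corthogonal_mat_def diagonal_mat_def Let_def by fastforce
  have G: "mat_adjoint W * W = rdiag n (\<lambda>i. s i * s i)"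
    using W by (intro eq_matI) (auto simp: rdiag_index diag off simp del: index_mult_mat(1))
  have s0: "s i \<noteq> 0" if "i < n" for i
    using diag[OF that] off[OF that that] by auto
  define N where "N = W * rdiag n (\<lambda>i. 1 / s i)"
  have N: "N \<in> carrier_mat n n"
    using W by (auto simp: N_def)
  have "mat_adjoint N * N = rdiag n (\<lambda>i. 1 / s i) * ((mat_adjoint W * W) * rdiag n (\<lambda>i. 1 / s i))"
    using W by (simp add: N_def mat_adjoint_mult[of _ n n _ n] assoc_mult_mat[of _ n n _ n _ n]
        mult_carrier_mat[of _ n n])
  also have "\<dots> = rdiag n (\<lambda>i. 1)"
    unfolding G rdiag_mult using s0 by (intro rdiag_cong) simp
  finally have "mat_adjoint N * N = 1\<^sub>m n"
    by (simp add: rdiag_def)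
  then have "unitary_mat n N"
    using mat_mult_left_right_inverse[of "mat_adjoint N" n N] N by (simp add: unitary_mat_def)
  moreover have "col N 0 = complex_of_real (1 / s 0) \<cdot>\<^sub>v v"
    using W W0 n v by (intro eq_vecI)
      (auto simp: N_def rdiag_mult_index mult.commute simp del: index_mult_mat(1))
  ultimately show ?thesis
    by blast
qed

lemma hermitian_mat_conj:
  assumes "hermitian_mat n A" "W \<in> carrier_mat n n"
  shows "hermitian_mat n (mat_adjoint W * A * W)"
  using assms by (auto simp: hermitian_mat_def mat_adjoint_mult[of _ n n _ n]
      assoc_mult_mat[of _ n n _ n _ n] mult_carrier_mat[of _ n n])

lemma hermitian_mat_index:
  assumes "hermitian_mat n A" "i < n" "j < n"
  shows "A $$ (j, i) = cnj (A $$ (i, j))"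
  using assms mat_adjoint_index[of j A i] by (auto simp: hermitian_mat_def)

lemma block_diag_mult:
  fixes A B C D :: "complex mat"
  assumes "A \<in> carrier_mat k k" "B \<in> carrier_mat k k" "C \<in> carrier_mat m m" "D \<in> carrier_mat m m"
  shows "four_block_mat A (0\<^sub>m k m) (0\<^sub>m m k) C * four_block_mat B (0\<^sub>m k m) (0\<^sub>m m k) D
    = four_block_mat (A * B) (0\<^sub>m k m) (0\<^sub>m m k) (C * D)"
  using assms mult_carrier_mat[OF assms(1,2)] mult_carrier_mat[OF assms(3,4)]
  by (subst mult_four_block_mat[of _ k k _ m _ m _ _ k _ m]) auto

text \<open>Deflation, by induction on a given list of roots rather than on the dimension alone: the
  eigenvalues then appear on the diagonal in exactly the order of \<open>es\<close>, and any order
  may be prescribed. Realness of the roots is not assumed; it is derived from this lemma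
  later.\<close>

lemma hermitian_mat_spectral_complex:
  assumes "hermitian_mat n A" "char_poly A = (\<Prod>e\<leftarrow>es. [:- e, 1:])"
  shows "\<exists>U. unitary_mat n U \<and> A = U * mat_diag n (\<lambda>i. es ! i) * mat_adjoint U"
  using assms
proof (induction es arbitrary: n A)
  case Nil
  then have "n = 0"
    using degree_monic_char_poly[of A n] by (auto simp: hermitian_mat_def)
  with Nil have "unitary_mat n (1\<^sub>m n) \<and> A = 1\<^sub>m n * mat_diag n (\<lambda>i. [] ! i) * mat_adjoint (1\<^sub>m n)"
    by (auto simp: unitary_mat_def hermitian_mat_def intro!: eq_matI)
  then show ?case
    by blast
next
  case (Cons e es)
  have A: "A \<in> carrier_mat n n"
    using Cons by (auto simp: hermitian_mat_def)
  have "eigenvalue A e"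
    unfolding eigenvalue_root_char_poly[OF A] Cons.prems(2) by simp
  then obtain v where v: "v \<in> carrier_vec n" "v \<noteq> 0\<^sub>v n" and ev: "A *\<^sub>v v = e \<cdot>\<^sub>v v"
    using A by (auto simp: eigenvalue_def eigenvector_def)
  then obtain m where n: "n = Suc m"
    by (cases n) auto
  then have n0: "0 < n"
    by simp
  obtain W c where W: "unitary_mat n W" and col: "col W 0 = c \<cdot>\<^sub>v v"
    using unitary_mat_extend_vec[OF v] by auto
  note Wc = unitary_matD[OF W]
  define A' where "A' = mat_adjoint W * A * W"
  have A': "A' \<in> carrier_mat n n" and hA': "hermitian_mat n A'"
    using hermitian_mat_conj[OF Cons.prems(1) Wc(1)] by (auto simp: A'_def hermitian_mat_def)
  have AW: "A = W * A' * mat_adjoint W"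
    using A Wc by (simp add: A'_def assoc_mult_mat[of _ n n _ n _ n] mult_carrier_mat[of _ n n]
        unitary_mat_cancel[OF W])
  have "(A * W) $$ (i, 0) = e * W $$ (i, 0)" if "i < n" for i
  proof -
    have "(A * W) $$ (i, 0) = (A *\<^sub>v col W 0) $ i"
      using that A Wc n by auto
    also have "A *\<^sub>v col W 0 = e \<cdot>\<^sub>v col W 0"
      using v A by (simp add: col ev mult_mat_vec[of _ n n] smult_smult_assoc mult.commute)
    finally show ?thesis
      using that Wc n by simp
  qed
  note AW0 = this
  \<comment> \<open>Column 0 of \<open>W\<close> is a multiple of an eigenvector, so column 0 of
    \<open>A'\<close> is \<open>e\<close> times column 0 of the identity.\<close>
  have "A' $$ (i, 0) = e * (mat_adjoint W * W) $$ (i, 0)" if "i < n" for i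
  proof -
    have A'': "A' = mat_adjoint W * (A * W)"
      using A Wc(1) by (simp add: A'_def assoc_mult_mat[of _ n n _ n _ n])
    have "A' $$ (i, 0) = (\<Sum>l<n. mat_adjoint W $$ (i, l) * (e * W $$ (l, 0)))"
      unfolding A'' using that A Wc(1) n0 AW0
      by (subst mult_mat_index[of _ n n _ n]) (auto simp del: index_mult_mat(1) mat_adjoint_index)
    also have "\<dots> = e * (mat_adjoint W * W) $$ (i, 0)"
      using that Wc(1) n0 by (subst mult_mat_index[of _ n n _ n])
        (auto simp: sum_distrib_left mult.left_commute simp del: mat_adjoint_index intro!: sum.cong)
    finally show ?thesis .
  qed
  then have c0: "A' $$ (i, 0) = (if i = 0 then e else 0)" if "i < n" for i
    using that n by (simp add: Wc)
  \<comment> \<open>Hermiticity carries the zeros of the first column over to the first row, so the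
    block form is diagonal and not merely triangular.\<close>
  have r0: "A' $$ (0, j) = 0" if "j < n" "j \<noteq> 0" for j
    using hermitian_mat_index[OF hA', of j 0] c0[of j] that n by simp
  define E where "E = mat 1 1 (\<lambda>_. e)"
  define A3 where "A3 = mat m m (\<lambda>(i, j). A' $$ (Suc i, Suc j))"
  have E: "E \<in> carrier_mat 1 1" and A3: "A3 \<in> carrier_mat m m"
    by (auto simp: E_def A3_def)
  have block: "A' = four_block_mat E (0\<^sub>m 1 m) (0\<^sub>m m 1) A3"
    using A' c0 r0 n E A3 by (intro eq_matI) (auto simp: E_def A3_def)
  have "cnj (A' $$ (Suc j, Suc i)) = A' $$ (Suc i, Suc j)" if "i < m" "j < m" for i j
    using hermitian_mat_index[OF hA', of "Suc j" "Suc i"] that n by simp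
  then have "mat_adjoint A3 = A3"
    by (intro eq_matI) (auto simp: A3_def)
  then have "hermitian_mat m A3"
    using A3 by (simp add: hermitian_mat_def)
  moreover have "char_poly A3 = (\<Prod>e\<leftarrow>es. [:- e, 1:])"
  proof -
    have "similar_mat A A'"
      by (rule similar_matI[of _ _ W "mat_adjoint W" n]) (use A A' Wc AW in auto)
    then have "char_poly A = char_poly A'"
      by (rule char_poly_similar)
    also have "\<dots> = char_poly E * char_poly A3"
      unfolding block by (rule char_poly_four_block_zeros_col[OF E _ A3]) simp
    also have "char_poly E = [:- e, 1:]"
      by (simp add: E_def char_poly_defs det_def sign_def)
    finally have "[:- e, 1:] * (\<Prod>e\<leftarrow>es. [:- e, 1:]) = [:- e, 1:] * char_poly A3"
      by (simp only: Cons.prems(2) list.map prod_list.Cons)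
    then have "(\<Prod>e\<leftarrow>es. [:- e, 1:]) = char_poly A3"
      by (subst (asm) mult_cancel_left) simp
    then show ?thesis ..
  qed
  ultimately obtain V where V: "unitary_mat m V"
    and A3V: "A3 = V * mat_diag m (\<lambda>i. es ! i) * mat_adjoint V"
    using Cons.IH by blast
  note Vc = unitary_matD[OF V]
  define V' where "V' = four_block_mat (1\<^sub>m 1) (0\<^sub>m 1 m) (0\<^sub>m m 1) V"
  have V'c: "V' \<in> carrier_mat n n"
    using Vc n by (auto simp: V'_def)
  have adjV': "mat_adjoint V' = four_block_mat (1\<^sub>m 1) (0\<^sub>m 1 m) (0\<^sub>m m 1) (mat_adjoint V)"
    using Vc by (intro eq_matI) (auto simp: V'_def)
  have "V' * mat_adjoint V' = four_block_mat (1\<^sub>m 1) (0\<^sub>m 1 m) (0\<^sub>m m 1) (1\<^sub>m m)"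
    unfolding adjV' unfolding V'_def
    using Vc by (simp add: block_diag_mult[of _ 1 _ _ m] del: One_nat_def)
  also have "\<dots> = 1\<^sub>m n"
    using n by (intro eq_matI) auto
  finally have V': "unitary_mat n V'"
    using V'c by (simp add: unitary_mat_def)
  have D: "mat_diag n (\<lambda>i. (e # es) ! i)
      = four_block_mat E (0\<^sub>m 1 m) (0\<^sub>m m 1) (mat_diag m (\<lambda>i. es ! i))"
    using n by (intro eq_matI) (auto simp: mat_diag_def E_def nth_Cons')
  have "V' * mat_diag n (\<lambda>i. (e # es) ! i) * mat_adjoint V' = A'"
    unfolding adjV' D block A3V unfolding V'_def using Vc E
    by (simp add: block_diag_mult[of _ 1 _ _ m] left_mult_one_mat[of _ 1 1] right_mult_one_mat[of _ 1 1]
        mult_carrier_mat[of _ m m] del: One_nat_def)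
  then have "A = (W * V') * mat_diag n (\<lambda>i. (e # es) ! i) * mat_adjoint (W * V')"
    using Wc(1) V'c AW
    by (simp add: mat_adjoint_mult[of _ n n _ n] assoc_mult_mat[of _ n n _ n _ n]
        mult_carrier_mat[of _ n n] flip: \<open>_ = A'\<close>)
  then show ?case
    using unitary_mat_mult[OF W V'] by blast
qed

text \<open>Equal products have equal root sets, so both heads are the largest root; cancelling that
  factor leaves the tails. This is the uniqueness behind \<open>eig_desc\<close>.\<close>

lemma linear_factors_desc_unique:
  fixes es fs :: "real list"
  assumes "sorted_wrt (\<ge>) es" "sorted_wrt (\<ge>) fs" "length es = length fs"
    and "(\<Prod>e\<leftarrow>es. [:- complex_of_real e, 1:]) = (\<Prod>e\<leftarrow>fs. [:- complex_of_real e, 1:])"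
  shows "es = fs"
  using assms
proof (induction es arbitrary: fs)
  case (Cons e es)
  then obtain f fs' where fs: "fs = f # fs'"
    by (cases fs) auto
  have roots: "poly (\<Prod>e\<leftarrow>gs. [:- complex_of_real e, 1:]) (complex_of_real x) = 0 \<longleftrightarrow> x \<in> set gs" for x gs
    by (induction gs) auto
  from roots[of "e # es"] roots[of fs] have set_eq: "set (e # es) = set fs"
    unfolding Cons.prems(4) by blast
  have "e = f"
    using set_eq Cons.prems(1,2) unfolding fs by (metis antisym insertE insertI1 list.simps(15) order_refl sorted_wrt.simps(2))
  moreover have "es = fs'"
  proof (rule Cons.IH)
    show "(\<Prod>e\<leftarrow>es. [:- complex_of_real e, 1:]) = (\<Prod>e\<leftarrow>fs'. [:- complex_of_real e, 1:])"
      using Cons.prems(4) unfolding fs \<open>e = f\<close> list.map prod_list.Cons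
      by (subst (asm) mult_cancel_left) simp
  qed (use Cons.prems fs in auto)
  ultimately show ?case
    by (simp add: fs)
qed simp

lemma prod_list_map_mset_cong:
  fixes f :: "'a \<Rightarrow> 'b::comm_monoid_mult"
  assumes "mset xs = mset ys"
  shows "prod_list (map f xs) = prod_list (map f ys)"
proof -
  have "prod_list (map f zs) = prod_mset (image_mset f (mset zs))" for zs
    by (induction zs) auto
  with assms show ?thesis
    by simp
qed

lemma eig_desc_props:
  assumes h: "hermitian_mat n A"
  shows "length (eig_desc A) = n" "sorted_wrt (\<ge>) (eig_desc A)"
    "char_poly A = (\<Prod>e\<leftarrow>eig_desc A. [:- complex_of_real e, 1:])"
proof -
  have A: "A \<in> carrier_mat n n"
    using h by (simp add: hermitian_mat_def)
  obtain as where as: "char_poly A = (\<Prod>a\<leftarrow>as. [:- a, 1:])" "length as = n"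
    using char_poly_factorized[OF A] by auto
  obtain U where U: "unitary_mat n U" and AU: "A = U * mat_diag n (\<lambda>i. as ! i) * mat_adjoint U"
    using hermitian_mat_spectral_complex[OF h as(1)] by auto
  note Uc = unitary_matD[OF U]
  \<comment> \<open>The diagonal matrix inherits hermiticity from \<open>A\<close>, so each root
    equals its own conjugate.\<close>
  have "mat_diag n (\<lambda>i. as ! i) = mat_adjoint U * A * U"
    using Uc by (simp add: AU assoc_mult_mat[of _ n n _ n _ n] mult_carrier_mat[of _ n n]
        unitary_mat_cancel[OF U] right_mult_one_mat[of _ n n])
  then have hD: "hermitian_mat n (mat_diag n (\<lambda>i. as ! i))"
    using hermitian_mat_conj[OF h Uc(1)] by simp
  have "as ! i = complex_of_real (Re (as ! i))" if "i < n" for i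
  proof -
    have "mat_diag n (\<lambda>i. as ! i) $$ (i, i) = as ! i"
      using that by (simp add: mat_diag_def)
    with hermitian_mat_index[OF hD that that] have "cnj (as ! i) = as ! i"
      by metis
    then show ?thesis
      by (metis Reals_cnj_iff of_real_Re)
  qed
  then have as': "as = map complex_of_real (map Re as)"
    using as(2) by (intro nth_equalityI) auto
  define es where "es = rev (sort (map Re as))"
  have "mset (map complex_of_real es) = mset as"
    by (subst as') (simp add: es_def multiset.map_comp)
  then have "prod_list (map (\<lambda>a. [:- a, 1:]) (map complex_of_real es)) = (\<Prod>a\<leftarrow>as. [:- a, 1:])"
    by (rule prod_list_map_mset_cong)
  then have es: "length es = n \<and> sorted_wrt (\<ge>) es \<and>
      char_poly A = (\<Prod>e\<leftarrow>es. [:- complex_of_real e, 1:])"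
    using as by (simp add: es_def sorted_wrt_rev o_def)
  have "\<exists>!es. length es = dim_row A \<and> sorted_wrt (\<ge>) es \<and>
      char_poly A = (\<Prod>e\<leftarrow>es. [:- complex_of_real e, 1:])"
    using es A linear_factors_desc_unique by (intro ex1I[of _ es]) auto
  from theI'[OF this] show "length (eig_desc A) = n" "sorted_wrt (\<ge>) (eig_desc A)"
    "char_poly A = (\<Prod>e\<leftarrow>eig_desc A. [:- complex_of_real e, 1:])"
    using A by (auto simp: eig_desc_def)
qed

text \<open>Equality of multisets leaves the order free: the maximum needs the decreasing list, the
  minimum the increasing one.\<close>

lemma hermitian_mat_spectral:
  assumes "hermitian_mat n A" and es: "mset es = mset (eig_desc A)"
  shows "\<exists>U. unitary_mat n U \<and> A = U * rdiag n (\<lambda>i. es ! i) * mat_adjoint U"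
proof -
  note e = eig_desc_props[OF assms(1)]
  have len: "length es = n"
    using e(1) es by (metis size_mset)
  have "char_poly A = (\<Prod>a\<leftarrow>map complex_of_real es. [:- a, 1:])"
    using e(3) prod_list_map_mset_cong[OF es, of "\<lambda>e. [:- complex_of_real e, 1:]"] by (simp add: o_def)
  then obtain U where U: "unitary_mat n U"
    "A = U * mat_diag n (\<lambda>i. map complex_of_real es ! i) * mat_adjoint U"
    using hermitian_mat_spectral_complex[OF assms(1)] by blast
  moreover have "mat_diag n (\<lambda>i. map complex_of_real es ! i) = rdiag n (\<lambda>i. es ! i)"
    using len by (intro eq_matI) (auto simp: rdiag_def mat_diag_def)
  ultimately show ?thesis
    by metis
qed

lemma psd_mat_eig_nonneg:
  assumes A: "psd_mat n A" and x: "x \<in> set (eig_desc A)"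
  shows "0 \<le> x"
proof -
  have h: "hermitian_mat n A"
    using A by (simp add: psd_mat_def)
  obtain U where U: "unitary_mat n U" and AU: "A = U * rdiag n (\<lambda>i. eig_desc A ! i) * mat_adjoint U"
    using hermitian_mat_spectral[OF h refl] by auto
  have D: "mat_adjoint U * A * U = rdiag n (\<lambda>i. eig_desc A ! i)"
    using unitary_matD[OF U] by (subst AU) (simp add: assoc_mult_mat[of _ n n _ n _ n]
        mult_carrier_mat[of _ n n] unitary_mat_cancel[OF U])
  obtain i where i: "i < n" "x = eig_desc A ! i"
    using x eig_desc_props(1)[OF h] by (metis in_set_conv_nth)
  then show ?thesis
    using psd_mat_diagonal_nonneg[OF A unitary_matD(1)[OF U] i(1)] by (simp add: D rdiag_index)
qed

lemma psd_mat_spectral: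
  assumes "psd_mat n A"
  shows "\<exists>U f. unitary_mat n U \<and> (\<forall>i<n. 0 \<le> f i) \<and> A = U * rdiag n f * mat_adjoint U"
proof -
  have h: "hermitian_mat n A"
    using assms by (simp add: psd_mat_def)
  show ?thesis
    using hermitian_mat_spectral[OF h refl] psd_mat_eig_nonneg[OF assms] eig_desc_props(1)[OF h]
    by (metis nth_mem)
qed

text \<open>If \<open>B = Q diag(b) Q*\<close> is another positive root, comparing squares in the matrix \<open>X = Q* U\<close>
  gives \<open>b\<^sub>i\<^sup>2 X\<^sub>i\<^sub>j = X\<^sub>i\<^sub>j f\<^sub>j\<close>; nonnegativity removes the squares entrywise.\<close>

lemma mat_sqrt_conj_rdiag:
  assumes U: "unitary_mat n U" and f: "\<And>i. i < n \<Longrightarrow> 0 \<le> f i"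
  shows "mat_sqrt (U * rdiag n f * mat_adjoint U) = U * rdiag n (\<lambda>i. sqrt (f i)) * mat_adjoint U"
  unfolding mat_sqrt_def
proof (rule the_equality)
  note Uc = unitary_matD[OF U]
  let ?A = "U * rdiag n f * mat_adjoint U" and ?B = "U * rdiag n (\<lambda>i. sqrt (f i)) * mat_adjoint U"
  have dim: "dim_row ?A = n"
    using Uc by simp
  have "rdiag n (\<lambda>i. sqrt (f i) * sqrt (f i)) = rdiag n f"
    using f by (intro rdiag_cong) simp
  then show "psd_mat (dim_row ?A) ?B \<and> ?B * ?B = ?A"
    unfolding dim conj_rdiag_mult[OF U] using f by (simp add: psd_mat_conj_rdiag[OF U])
  fix B assume B: "psd_mat (dim_row ?A) B \<and> B * B = ?A"
  then obtain Q b where Q: "unitary_mat n Q" and b: "\<And>i. i < n \<Longrightarrow> 0 \<le> b i"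
    and BQ: "B = Q * rdiag n b * mat_adjoint Q"
    using psd_mat_spectral[of n B] unfolding dim by blast
  note Qc = unitary_matD[OF Q]
  define X where "X = mat_adjoint Q * U"
  have X: "X \<in> carrier_mat n n"
    using Qc Uc by (auto simp: X_def)
  have "Q * rdiag n (\<lambda>i. b i * b i) * mat_adjoint Q = ?A"
    using B by (simp add: BQ conj_rdiag_mult[OF Q])
  then have "mat_adjoint Q * (Q * rdiag n (\<lambda>i. b i * b i) * mat_adjoint Q) * U = mat_adjoint Q * ?A * U"
    by simp
  then have eq: "rdiag n (\<lambda>i. b i * b i) * X = X * rdiag n f"
    using Qc Uc by (simp add: X_def assoc_mult_mat[of _ n n _ n _ n] mult_carrier_mat[of _ n n]
        right_mult_one_mat[of _ n n] unitary_mat_cancel[OF U] unitary_mat_cancel[OF Q])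
  have "complex_of_real (b i) * X $$ (i, j) = X $$ (i, j) * complex_of_real (sqrt (f j))"
    if ij: "i < n" "j < n" for i j
  proof (cases "X $$ (i, j) = 0")
    case False
    have "complex_of_real (b i * b i) * X $$ (i, j) = X $$ (i, j) * complex_of_real (f j)"
      using arg_cong[OF eq, of "\<lambda>M. M $$ (i, j)"] by (simp only: rdiag_mult_index[OF X ij])
    then have "b i * b i = f j"
      using False by (metis mult.commute mult_cancel_left of_real_eq_iff)
    then have "sqrt (f j) = b i"
      using b[OF ij(1)] by (metis real_sqrt_mult_self abs_of_nonneg real_sqrt_abs2)
    then show ?thesis
      by simp
  qed simp
  then have "rdiag n b * X = X * rdiag n (\<lambda>i. sqrt (f i))"
    using X by (intro eq_matI) (auto simp: rdiag_mult_index simp del: index_mult_mat(1))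
  then have "Q * (rdiag n b * X) * mat_adjoint U = Q * (X * rdiag n (\<lambda>i. sqrt (f i))) * mat_adjoint U"
    by simp
  then show "B = ?B"
    using Qc Uc by (simp add: BQ X_def assoc_mult_mat[of _ n n _ n _ n] mult_carrier_mat[of _ n n]
        unitary_mat_cancel[OF U] unitary_mat_cancel[OF Q])
qed

section \<open>Partial isometries\<close>

text \<open>\<open>Z * mat_adjoint Z\<close> is an orthogonal projection G. Its diagonal entry r is
  the sum in question and also the squared norm of row \<open>i\<close> of G, hence at least r
  squared; so r is at most one.\<close>

lemma partial_isometry_row_le:
  fixes Z :: "complex mat"
  assumes Z: "Z \<in> carrier_mat n n" and iso: "Z * mat_adjoint Z * Z = Z" and i: "i < n"
  shows "(\<Sum>j<n. (cmod (Z $$ (i, j)))\<^sup>2) \<le> 1"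
proof -
  define G where "G = Z * mat_adjoint Z"
  define r where "r = (\<Sum>j<n. (cmod (Z $$ (i, j)))\<^sup>2)"
  have G: "G \<in> carrier_mat n n"
    using Z by (auto simp: G_def)
  have "mat_adjoint G = G"
    using Z by (simp add: G_def mat_adjoint_mult[of _ n n _ n])
  then have "G * mat_adjoint G = (Z * mat_adjoint Z * Z) * mat_adjoint Z"
    using Z by (simp add: G_def assoc_mult_mat[of _ n n _ n _ n] mult_carrier_mat[of _ n n])
  also have "\<dots> = G"
    unfolding iso G_def ..
  finally have GG: "G * mat_adjoint G = G" .
  have Gi: "G $$ (i, i) = complex_of_real r"
    unfolding G_def r_def by (rule gram_diag[OF Z i])
  have "complex_of_real (\<Sum>j<n. (cmod (G $$ (i, j)))\<^sup>2) = complex_of_real r"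
    using gram_diag[OF G i] unfolding GG Gi by simp
  then have "r = (\<Sum>j<n. (cmod (G $$ (i, j)))\<^sup>2)"
    by (simp only: of_real_eq_iff)
  also have "\<dots> \<ge> (cmod (G $$ (i, i)))\<^sup>2"
    by (rule member_le_sum) (use i in auto)
  finally have rr: "r * r \<le> r"
    by (simp add: Gi power2_eq_square)
  have "r \<le> 1"
  proof (rule ccontr)
    assume "\<not> r \<le> 1"
    then have "1 * r < r * r"
      by (intro mult_strict_right_mono) auto
    with rr show False
      by simp
  qed
  then show ?thesis
    by (simp add: r_def)
qed

text \<open>The adjoint of a partial isometry is again one.\<close>

lemma partial_isometry_col_le:
  fixes Z :: "complex mat"
  assumes Z: "Z \<in> carrier_mat n n" and iso: "Z * mat_adjoint Z * Z = Z" and j: "j < n"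
  shows "(\<Sum>i<n. (cmod (Z $$ (i, j)))\<^sup>2) \<le> 1"
proof -
  have "mat_adjoint Z * mat_adjoint (mat_adjoint Z) * mat_adjoint Z = mat_adjoint (Z * mat_adjoint Z * Z)"
    using Z by (simp add: mat_adjoint_mult[of _ n n _ n] assoc_mult_mat[of _ n n _ n _ n]
        mult_carrier_mat[of _ n n])
  then have "(\<Sum>i<n. (cmod (mat_adjoint Z $$ (j, i)))\<^sup>2) \<le> 1"
    using Z j iso by (intro partial_isometry_row_le) auto
  also have "(\<Sum>i<n. (cmod (mat_adjoint Z $$ (j, i)))\<^sup>2) = (\<Sum>i<n. (cmod (Z $$ (i, j)))\<^sup>2)"
    using Z j by (intro sum.cong) auto
  finally show ?thesis .
qed

lemma unitary_mat_row:
  assumes "unitary_mat n U" "i < n"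
  shows "(\<Sum>j<n. (cmod (U $$ (i, j)))\<^sup>2) = 1"
proof -
  have "complex_of_real (\<Sum>j<n. (cmod (U $$ (i, j)))\<^sup>2) = complex_of_real 1"
    using gram_diag[OF unitary_matD(1)[OF assms(1)] assms(2)] unitary_matD(2)[OF assms(1)] assms(2)
    by simp
  then show ?thesis
    by (simp only: of_real_eq_iff)
qed

lemma gram_col:
  fixes D :: "complex mat"
  assumes "D \<in> carrier_mat n n" "k < n"
  shows "(mat_adjoint D * D) $$ (k, k) = complex_of_real (\<Sum>i<n. (cmod (D $$ (i, k)))\<^sup>2)"
  using gram_diag[of "mat_adjoint D" n n k] assms by (auto intro!: sum.cong)

lemma unitary_mat_col:
  assumes "unitary_mat n U" "j < n"
  shows "(\<Sum>i<n. (cmod (U $$ (i, j)))\<^sup>2) = 1"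
proof -
  have "complex_of_real (\<Sum>i<n. (cmod (U $$ (i, j)))\<^sup>2) = complex_of_real 1"
    using gram_col[OF unitary_matD(1)[OF assms(1)] assms(2)] unitary_matD(3)[OF assms(1)] assms(2)
    by simp
  then show ?thesis
    by (simp only: of_real_eq_iff)
qed

section \<open>Rearrangement inequalities\<close>

lemma sum_triangle_swap:
  fixes f :: "nat \<Rightarrow> nat \<Rightarrow> 'a::comm_monoid_add"
  shows "(\<Sum>i<n. \<Sum>k\<in>{i..<n}. f i k) = (\<Sum>k<n. \<Sum>i\<le>k. f i k)"
proof -
  have "(\<Sum>i<n. \<Sum>k\<in>{i..<n}. f i k) = (\<Sum>(i, k)\<in>(SIGMA i:{..<n}. {i..<n}). f i k)"
    by (rule sum.Sigma) auto
  also have "\<dots> = (\<Sum>(k, i)\<in>(SIGMA k:{..<n}. {..k}). f i k)"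
    by (rule sum.reindex_bij_witness[of _ "\<lambda>(k, i). (i, k)" "\<lambda>(i, k). (k, i)"]) auto
  also have "\<dots> = (\<Sum>k<n. \<Sum>i\<le>k. f i k)"
    by (rule sum.Sigma[symmetric]) auto
  finally show ?thesis .
qed

text \<open>Abel summation in both indices: each \<open>x i\<close> is the sum of the decrements
  \<open>dx k\<close> with k at least i, and likewise for \<open>y\<close>. Values from index
  \<open>n\<close> on count as zero, so the last decrement is the last entry itself.\<close>

lemma desc_bilinear_abel:
  fixes x y :: "nat \<Rightarrow> real" and W :: "nat \<Rightarrow> nat \<Rightarrow> real" and n :: nat
  defines "dx \<equiv> \<lambda>k. (if k < n then x k else 0) - (if Suc k < n then x (Suc k) else 0)"
    and "dy \<equiv> \<lambda>k. (if k < n then y k else 0) - (if Suc k < n then y (Suc k) else 0)"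
  shows "(\<Sum>i<n. \<Sum>j<n. W i j * (x i * y j))
    = (\<Sum>k<n. \<Sum>l<n. dx k * dy l * (\<Sum>i\<le>k. \<Sum>j\<le>l. W i j))"
proof -
  have tele: "z i = (\<Sum>k\<in>{i..<n}. (if k < n then z k else 0) - (if Suc k < n then z (Suc k) else 0))"
    if "i < n" for z :: "nat \<Rightarrow> real" and i
  proof -
    have "(\<Sum>k\<in>{i..<n}. - (if Suc k < n then z (Suc k) else 0) - - (if k < n then z k else 0)) = z i"
      using that sum_Suc_diff'[of i n "\<lambda>k. - (if k < n then z k else 0)"] by simp
    then show ?thesis
      by (simp add: algebra_simps)
  qed
  have "W i j * (x i * y j) = (\<Sum>k\<in>{i..<n}. \<Sum>l\<in>{j..<n}. dx k * dy l * W i j)"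
    if i: "i < n" and j: "j < n" for i j
  proof -
    have "W i j * (x i * y j) = (sum dx {i..<n} * sum dy {j..<n}) * W i j"
      using tele[OF i, of x] tele[OF j, of y] unfolding dx_def dy_def
      by (metis mult.commute)
    also have "\<dots> = (\<Sum>k\<in>{i..<n}. \<Sum>l\<in>{j..<n}. dx k * dy l * W i j)"
      unfolding sum_product unfolding sum_distrib_right ..
    finally show ?thesis .
  qed
  then have "(\<Sum>i<n. \<Sum>j<n. W i j * (x i * y j))
      = (\<Sum>i<n. \<Sum>j<n. \<Sum>k\<in>{i..<n}. \<Sum>l\<in>{j..<n}. dx k * dy l * W i j)"
    by (intro sum.cong refl) auto
  also have "\<dots> = (\<Sum>i<n. \<Sum>k\<in>{i..<n}. \<Sum>j<n. \<Sum>l\<in>{j..<n}. dx k * dy l * W i j)"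
    by (intro sum.cong refl sum.swap)
  also have "\<dots> = (\<Sum>k<n. \<Sum>i\<le>k. \<Sum>j<n. \<Sum>l\<in>{j..<n}. dx k * dy l * W i j)"
    by (rule sum_triangle_swap)
  also have "\<dots> = (\<Sum>k<n. \<Sum>i\<le>k. \<Sum>l<n. \<Sum>j\<le>l. dx k * dy l * W i j)"
    by (intro sum.cong refl sum_triangle_swap)
  also have "\<dots> = (\<Sum>k<n. \<Sum>l<n. \<Sum>i\<le>k. \<Sum>j\<le>l. dx k * dy l * W i j)"
    by (intro sum.cong refl sum.swap)
  finally show ?thesis
    by (simp add: sum_distrib_left)
qed

text \<open>All decrements are nonnegative: monotonicity handles those before the end, nonnegativity
  of the entries the last one. So it is enough to compare corner sums of \<open>W\<close> with those
  of the identity matrix. A corner sum of \<open>W\<close> is at most the length of the shorter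
  side, by rows or by columns, and the identity attains this.\<close>

lemma substochastic_rearrangement:
  fixes x y :: "nat \<Rightarrow> real" and W :: "nat \<Rightarrow> nat \<Rightarrow> real"
  assumes W: "\<And>i j. i < n \<Longrightarrow> j < n \<Longrightarrow> 0 \<le> W i j"
    and rows: "\<And>i. i < n \<Longrightarrow> (\<Sum>j<n. W i j) \<le> 1"
    and cols: "\<And>j. j < n \<Longrightarrow> (\<Sum>i<n. W i j) \<le> 1"
    and x: "\<And>i. i < n \<Longrightarrow> 0 \<le> x i" "\<And>i. Suc i < n \<Longrightarrow> x (Suc i) \<le> x i"
    and y: "\<And>i. i < n \<Longrightarrow> 0 \<le> y i" "\<And>i. Suc i < n \<Longrightarrow> y (Suc i) \<le> y i"
  shows "(\<Sum>i<n. \<Sum>j<n. W i j * (x i * y j)) \<le> (\<Sum>i<n. x i * y i)"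
proof -
  define \<Delta> where "\<Delta> z k = (if k < n then z k else 0) - (if Suc k < n then z (Suc k) else 0)"
    for z :: "nat \<Rightarrow> real" and k
  have \<Delta>: "0 \<le> \<Delta> x k" "0 \<le> \<Delta> y k" if "k < n" for k
    using x y that by (auto simp: \<Delta>_def)
  have corner: "(\<Sum>i\<le>k. \<Sum>j\<le>l. W i j) \<le> (\<Sum>i\<le>k. \<Sum>j\<le>l. of_bool (i = j))"
    if k: "k < n" and l: "l < n" for k l
  proof (cases "k \<le> l")
    case True
    have "(\<Sum>i\<le>k. \<Sum>j\<le>l. W i j) \<le> (\<Sum>i\<le>k. 1)"
    proof (rule sum_mono)
      fix i assume "i \<in> {..k}"
      then have i: "i < n"
        using k by simp
      have "(\<Sum>j\<le>l. W i j) \<le> (\<Sum>j<n. W i j)"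
        using W[OF i] l by (intro sum_mono2) auto
      then show "(\<Sum>j\<le>l. W i j) \<le> 1"
        using rows[OF i] by simp
    qed
    also have "\<dots> = (\<Sum>i\<le>k. \<Sum>j\<le>l. of_bool (i = j))"
      using True by (intro sum.cong) (auto simp: of_bool_def)
    finally show ?thesis .
  next
    case False
    have "(\<Sum>i\<le>k. \<Sum>j\<le>l. W i j) = (\<Sum>j\<le>l. \<Sum>i\<le>k. W i j)"
      by (rule sum.swap)
    also have "\<dots> \<le> (\<Sum>j\<le>l. 1)"
    proof (rule sum_mono)
      fix j assume "j \<in> {..l}"
      then have j: "j < n"
        using l by simp
      have "(\<Sum>i\<le>k. W i j) \<le> (\<Sum>i<n. W i j)"
        using W[OF _ j] k by (intro sum_mono2) auto
      then show "(\<Sum>i\<le>k. W i j) \<le> 1"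
        using cols[OF j] by simp
    qed
    also have "\<dots> = (\<Sum>j\<le>l. \<Sum>i\<le>k. of_bool (i = j))"
      using False by (intro sum.cong) (auto simp: of_bool_def)
    also have "\<dots> = (\<Sum>i\<le>k. \<Sum>j\<le>l. of_bool (i = j))"
      by (rule sum.swap)
    finally show ?thesis .
  qed
  have "(\<Sum>i<n. \<Sum>j<n. W i j * (x i * y j))
      = (\<Sum>k<n. \<Sum>l<n. \<Delta> x k * \<Delta> y l * (\<Sum>i\<le>k. \<Sum>j\<le>l. W i j))"
    unfolding \<Delta>_def by (rule desc_bilinear_abel)
  also have "\<dots> \<le> (\<Sum>k<n. \<Sum>l<n. \<Delta> x k * \<Delta> y l * (\<Sum>i\<le>k. \<Sum>j\<le>l. of_bool (i = j)))"
    by (intro sum_mono mult_left_mono corner mult_nonneg_nonneg \<Delta>) auto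
  also have "\<dots> = (\<Sum>i<n. \<Sum>j<n. of_bool (i = j) * (x i * y j))"
    unfolding \<Delta>_def by (rule desc_bilinear_abel[symmetric])
  also have "\<dots> = (\<Sum>i<n. x i * y i)"
    by (intro sum.cong) (auto simp: of_bool_def if_distrib[of "\<lambda>c. c * _"] cong: if_cong)
  finally show ?thesis .
qed

text \<open>Reflecting \<open>y\<close> at its largest value reverses both the order and the
  inequality. Row sums equal to one make the added constant contribute the same to both
  sides.\<close>

lemma doubly_stochastic_rearrangement:
  fixes x y :: "nat \<Rightarrow> real" and W :: "nat \<Rightarrow> nat \<Rightarrow> real"
  assumes W: "\<And>i j. i < n \<Longrightarrow> j < n \<Longrightarrow> 0 \<le> W i j"
    and rows: "\<And>i. i < n \<Longrightarrow> (\<Sum>j<n. W i j) = 1"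
    and cols: "\<And>j. j < n \<Longrightarrow> (\<Sum>i<n. W i j) = 1"
    and x: "\<And>i. i < n \<Longrightarrow> 0 \<le> x i" "\<And>i. Suc i < n \<Longrightarrow> x (Suc i) \<le> x i"
    and y: "\<And>i. Suc i < n \<Longrightarrow> y i \<le> y (Suc i)"
  shows "(\<Sum>i<n. x i * y i) \<le> (\<Sum>i<n. \<Sum>j<n. W i j * (x i * y j))"
proof -
  have c: "y i \<le> y (n - 1)" if "i < n" for i
  proof -
    have "i \<le> n - 1"
      using that by simp
    then show ?thesis
    proof (induction rule: inc_induct)
      case (step k)
      then have "Suc k < n"
        by simp
      with y[of k] step show ?case
        by simp
    qed simp
  qed
  \<comment> \<open>\<open>y (n - 1) - y j\<close> is decreasing and nonnegative, so the substochastic bound applies to it.\<close>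
  have "(\<Sum>i<n. \<Sum>j<n. W i j * (x i * (y (n - 1) - y j))) \<le> (\<Sum>i<n. x i * (y (n - 1) - y i))"
    by (rule substochastic_rearrangement) (use W rows cols x y c in auto)
  moreover have "(\<Sum>i<n. \<Sum>j<n. W i j * (x i * (y (n - 1) - y j)))
      = (\<Sum>i<n. (\<Sum>j<n. W i j) * (x i * y (n - 1))) - (\<Sum>i<n. \<Sum>j<n. W i j * (x i * y j))"
    by (simp add: sum_distrib_right right_diff_distrib sum_subtractf)
  moreover have "(\<Sum>i<n. (\<Sum>j<n. W i j) * (x i * y (n - 1))) = (\<Sum>i<n. x i * y (n - 1))"
    using rows by (intro sum.cong) auto
  ultimately show ?thesis
    by (simp add: right_diff_distrib sum_subtractf)
qed

section \<open>Fidelity and singular values\<close>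

lemma mat_trace_conj_rdiag:
  assumes U: "unitary_mat n U"
  shows "mat_trace (U * rdiag n f * mat_adjoint U) = complex_of_real (\<Sum>i<n. f i)"
proof -
  note Uc = unitary_matD[OF U]
  have "mat_trace (U * rdiag n f * mat_adjoint U) = mat_trace (mat_adjoint U * (U * rdiag n f))"
    using Uc(1) by (intro mat_trace_comm[of _ n n]) auto
  also have "\<dots> = mat_trace (rdiag n f)"
    by (simp add: unitary_mat_cancel[OF U])
  finally show ?thesis
    by (simp add: mat_trace_eq[of _ n] rdiag_index)
qed

text \<open>With C = B A, the matrix under the outer root of the fidelity is the Gram matrix of C.
  Thus \<open>m\<close> lists the squared singular values and \<open>R\<close> the right singular
  vectors. Stating that the columns of C R are orthogonal with squared norms \<open>m\<close> avoids
  choosing left singular vectors where \<open>m\<close> vanishes.\<close>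

lemma fidelity_singular_values:
  assumes P: "unitary_mat n P" and Q: "unitary_mat n Q"
    and a: "\<And>i. i < n \<Longrightarrow> 0 \<le> a i" and b: "\<And>i. i < n \<Longrightarrow> 0 \<le> b i"
  defines "A \<equiv> P * rdiag n (\<lambda>i. sqrt (a i)) * mat_adjoint P"
    and "B \<equiv> Q * rdiag n (\<lambda>i. sqrt (b i)) * mat_adjoint Q"
  shows "\<exists>R m. unitary_mat n R \<and> (\<forall>i<n. 0 \<le> m i)
    \<and> mat_adjoint (B * A * R) * (B * A * R) = rdiag n m
    \<and> fidelity (P * rdiag n a * mat_adjoint P) (Q * rdiag n b * mat_adjoint Q) = (\<Sum>i<n. sqrt (m i))"
proof -
  note Pc = unitary_matD[OF P] and Qc = unitary_matD[OF Q]
  have A: "A \<in> carrier_mat n n" and B: "B \<in> carrier_mat n n"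
    using Pc(1) Qc(1) by (auto simp: A_def B_def)
  have "psd_mat n A"
    unfolding A_def by (rule psd_mat_conj_rdiag[OF P]) (simp add: a)
  then have Aadj: "mat_adjoint A = A"
    by (simp add: psd_mat_def hermitian_mat_def)
  have "psd_mat n B"
    unfolding B_def by (rule psd_mat_conj_rdiag[OF Q]) (simp add: b)
  then have Badj: "mat_adjoint B = B"
    by (simp add: psd_mat_def hermitian_mat_def)
  have "rdiag n (\<lambda>i. sqrt (b i) * sqrt (b i)) = rdiag n b"
    by (rule rdiag_cong) (simp add: b)
  then have BB: "B * B = Q * rdiag n b * mat_adjoint Q"
    unfolding B_def conj_rdiag_mult[OF Q] by simp
  define C where "C = B * A"
  have C: "C \<in> carrier_mat n n"
    using A B by (auto simp: C_def)
  have "mat_adjoint C * C = A * (B * B) * A"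
    using A B by (simp add: C_def mat_adjoint_mult[of _ n n _ n] Aadj Badj
        assoc_mult_mat[of _ n n _ n _ n] mult_carrier_mat[of _ n n])
  then have M: "mat_adjoint C * C = A * (Q * rdiag n b * mat_adjoint Q) * A"
    by (simp only: BB)
  obtain R m where R: "unitary_mat n R" and m: "\<forall>i<n. 0 \<le> m i"
    and CR: "mat_adjoint C * C = R * rdiag n m * mat_adjoint R"
    using psd_mat_spectral[OF psd_mat_gram[OF C]] by blast
  note Rc = unitary_matD[OF R]
  have "mat_adjoint (C * R) * (C * R) = mat_adjoint R * (mat_adjoint C * C) * R"
    using C Rc(1) by (simp add: mat_adjoint_mult[of _ n n _ n]
        assoc_mult_mat[of _ n n _ n _ n] mult_carrier_mat[of _ n n])
  also have "\<dots> = rdiag n m"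
    unfolding CR using Rc by (simp add: assoc_mult_mat[of _ n n _ n _ n] mult_carrier_mat[of _ n n]
        unitary_mat_cancel[OF R] right_mult_one_mat[of _ n n])
  finally have gram: "mat_adjoint (C * R) * (C * R) = rdiag n m" .
  have "mat_sqrt (P * rdiag n a * mat_adjoint P) = A"
    unfolding A_def by (rule mat_sqrt_conj_rdiag[OF P a])
  then have "fidelity (P * rdiag n a * mat_adjoint P) (Q * rdiag n b * mat_adjoint Q)
      = Re (mat_trace (mat_sqrt (R * rdiag n m * mat_adjoint R)))"
    by (simp only: fidelity_def M[symmetric] CR)
  also have "\<dots> = (\<Sum>i<n. sqrt (m i))"
    using m by (subst mat_sqrt_conj_rdiag[OF R]) (simp_all add: mat_trace_conj_rdiag[OF R])
  finally show ?thesis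
    using R m gram unfolding C_def by blast
qed

text \<open>In the orthonormal basis of columns r of \<open>R\<close>, the trace is the sum of the
  inner products of r with C r. Cauchy-Schwarz bounds each by the norm of C r, a singular
  value.\<close>

lemma Re_mat_trace_le_singular_values:
  assumes C: "C \<in> carrier_mat n n" and R: "unitary_mat n R"
    and gram: "mat_adjoint (C * R) * (C * R) = rdiag n m"
  shows "Re (mat_trace C) \<le> (\<Sum>k<n. sqrt (m k))"
proof -
  note Rc = unitary_matD[OF R]
  define D where "D = C * R"
  have D: "D \<in> carrier_mat n n"
    using C Rc(1) by (auto simp: D_def)
  have "C = D * mat_adjoint R"
    using C Rc by (simp add: D_def assoc_mult_mat[of _ n n _ n _ n] right_mult_one_mat[of _ n n])
  then have "mat_trace C = mat_trace (mat_adjoint R * D)"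
    using mat_trace_comm[OF D, of "mat_adjoint R"] Rc(1) by simp
  also have "\<dots> = (\<Sum>k<n. (mat_adjoint R * D) $$ (k, k))"
    by (rule mat_trace_eq) (use D Rc(1) in auto)
  finally have "Re (mat_trace C) = (\<Sum>k<n. Re ((mat_adjoint R * D) $$ (k, k)))"
    by (simp only: Re_sum)
  also have "\<dots> \<le> (\<Sum>k<n. sqrt (m k))"
  proof (rule sum_mono)
    fix k assume "k \<in> {..<n}"
    then have k: "k < n"
      by simp
    have "complex_of_real (\<Sum>i<n. (cmod (D $$ (i, k)))\<^sup>2) = complex_of_real (m k)"
      using gram_col[OF D k] k unfolding gram[folded D_def] by (simp only: rdiag_index refl if_True)
    then have mk: "(\<Sum>i<n. (cmod (D $$ (i, k)))\<^sup>2) = m k"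
      by (simp only: of_real_eq_iff)
    have entry: "(mat_adjoint R * D) $$ (k, k) = (\<Sum>i<n. cnj (R $$ (i, k)) * D $$ (i, k))"
      using k D Rc(1) by (subst mult_mat_index[of _ n n _ n]) (auto intro!: sum.cong)
    have "Re ((mat_adjoint R * D) $$ (k, k)) \<le> cmod (\<Sum>i<n. cnj (R $$ (i, k)) * D $$ (i, k))"
      unfolding entry by (rule complex_Re_le_cmod)
    also have "\<dots> \<le> (\<Sum>i<n. \<bar>cmod (R $$ (i, k))\<bar> * \<bar>cmod (D $$ (i, k))\<bar>)"
      by (rule order_trans[OF norm_sum]) (simp add: norm_mult)
    also have "\<dots> \<le> L2_set (\<lambda>i. cmod (R $$ (i, k))) {..<n} * L2_set (\<lambda>i. cmod (D $$ (i, k))) {..<n}"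
      by (rule L2_set_mult_ineq)
    also have "\<dots> = sqrt (m k)"
      by (simp add: L2_set_def unitary_mat_col[OF R k] mk)
    finally show "Re ((mat_adjoint R * D) $$ (k, k)) \<le> sqrt (m k)" .
  qed
  finally show ?thesis .
qed

text \<open>\<open>V\<close> is the adjoint of the partial isometry in the polar decomposition of
  \<open>C\<close>, so \<open>V * C\<close> is the positive root of the Gram matrix of
  \<open>C\<close>.\<close>

lemma singular_values_eq_trace:
  assumes C: "C \<in> carrier_mat n n" and R: "unitary_mat n R" and m: "\<And>i. i < n \<Longrightarrow> 0 \<le> m i"
    and gram: "mat_adjoint (C * R) * (C * R) = rdiag n m"
  shows "\<exists>V \<in> carrier_mat n n. V * mat_adjoint V * V = V
    \<and> mat_trace (V * C) = complex_of_real (\<Sum>k<n. sqrt (m k))"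
proof -
  note Rc = unitary_matD[OF R]
  define D where "D = C * R"
  have D: "D \<in> carrier_mat n n"
    using C Rc(1) by (auto simp: D_def)
  have DD: "mat_adjoint D * (D * X) = rdiag n m * X" if "X \<in> carrier_mat n n" for X
    using D that gram[folded D_def] by (simp flip: assoc_mult_mat[of _ n n _ n _ n])
  \<comment> \<open>The pseudo-inverse of \<open>sqrt (m i)\<close>, since division by zero yields zero.\<close>
  define s where "s i = 1 / sqrt (m i)" for i
  define V where "V = R * rdiag n s * mat_adjoint D"
  have V: "V \<in> carrier_mat n n"
    using Rc(1) D by (auto simp: V_def)
  \<comment> \<open>Where \<open>m i\<close> is zero so is \<open>s i\<close>; elsewhere
    \<open>m i\<close> cancels two of the factors \<open>s i\<close>.\<close>
  have sms: "rdiag n (\<lambda>i. s i * (m i * (s i * s i))) = rdiag n s"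
  proof (rule rdiag_cong)
    fix i assume "i < n"
    then have "m i = sqrt (m i) * sqrt (m i)"
      using m by simp
    then show "s i * (m i * (s i * s i)) = s i"
      by (cases "m i = 0") (auto simp: s_def field_simps)
  qed
  have sm: "rdiag n (\<lambda>i. s i * m i) = rdiag n (\<lambda>i. sqrt (m i))"
    using m by (intro rdiag_cong) (simp add: s_def real_div_sqrt)
  have "V * mat_adjoint V * V = R * (rdiag n (\<lambda>i. s i * (m i * (s i * s i))) * mat_adjoint D)"
    using Rc D by (simp add: V_def mat_adjoint_mult[of _ n n _ n] assoc_mult_mat[of _ n n _ n _ n]
        mult_carrier_mat[of _ n n] DD unitary_mat_cancel[OF R] mult.assoc)
  also have "\<dots> = V"
    unfolding sms using Rc(1) D by (simp add: V_def assoc_mult_mat[of _ n n _ n _ n])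
  finally have iso: "V * mat_adjoint V * V = V" .
  have "C = D * mat_adjoint R"
    using C Rc by (simp add: D_def assoc_mult_mat[of _ n n _ n _ n] right_mult_one_mat[of _ n n])
  then have "V * C = R * rdiag n (\<lambda>i. s i * m i) * mat_adjoint R"
    using Rc D by (simp add: V_def assoc_mult_mat[of _ n n _ n _ n] mult_carrier_mat[of _ n n] DD)
  then have "mat_trace (V * C) = complex_of_real (\<Sum>k<n. sqrt (m k))"
    unfolding sm by (simp only: mat_trace_conj_rdiag[OF R])
  with iso V show ?thesis
    by blast
qed

text \<open>Cyclicity of the trace gathers the two changes of basis into Z and X. The upper bound
  uses it with a partial isometry \<open>V\<close>, the lower bound with the identity.\<close>

lemma mat_trace_mult_conj_rdiag:
  assumes V: "V \<in> carrier_mat n n" and P: "unitary_mat n P" and Q: "unitary_mat n Q"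
  shows "mat_trace (V * ((Q * rdiag n g * mat_adjoint Q) * (P * rdiag n f * mat_adjoint P)))
    = (\<Sum>i<n. \<Sum>j<n. complex_of_real (f i * g j)
        * ((mat_adjoint P * V * Q) $$ (i, j) * (mat_adjoint Q * P) $$ (j, i)))"
proof -
  note Pc = unitary_matD[OF P] and Qc = unitary_matD[OF Q]
  define Z X where "Z = mat_adjoint P * V * Q" and "X = mat_adjoint Q * P"
  have Z: "Z \<in> carrier_mat n n" and X: "X \<in> carrier_mat n n"
    using V Pc(1) Qc(1) by (auto simp: Z_def X_def)
  define T where "T = V * (Q * (rdiag n g * (mat_adjoint Q * (P * rdiag n f))))"
  have T: "T \<in> carrier_mat n n"
    using V Pc(1) Qc(1) by (auto simp: T_def intro!: mult_carrier_mat[of _ n n])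
  have "V * ((Q * rdiag n g * mat_adjoint Q) * (P * rdiag n f * mat_adjoint P)) = T * mat_adjoint P"
    using V Pc(1) Qc(1) by (simp add: T_def assoc_mult_mat[of _ n n _ n _ n] mult_carrier_mat[of _ n n])
  then have "mat_trace (V * ((Q * rdiag n g * mat_adjoint Q) * (P * rdiag n f * mat_adjoint P)))
      = mat_trace (mat_adjoint P * T)"
    using mat_trace_comm[OF T, of "mat_adjoint P"] Pc(1) by simp
  also have "mat_adjoint P * T = (Z * rdiag n g) * (X * rdiag n f)"
    using V Pc(1) Qc(1) by (simp add: T_def Z_def X_def assoc_mult_mat[of _ n n _ n _ n] mult_carrier_mat[of _ n n])
  also have "mat_trace \<dots> = (\<Sum>i<n. \<Sum>j<n. (Z * rdiag n g) $$ (i, j) * (X * rdiag n f) $$ (j, i))"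
  proof -
    have "Z * rdiag n g * (X * rdiag n f) \<in> carrier_mat n n"
      using Z X by (auto intro!: mult_carrier_mat[of _ n n])
    then show ?thesis
      using Z X by (simp only: mat_trace_eq[of _ n]) (intro sum.cong refl mult_mat_index[of _ n n _ n], auto)
  qed
  also have "\<dots> = (\<Sum>i<n. \<Sum>j<n. complex_of_real (f i * g j) * (Z $$ (i, j) * X $$ (j, i)))"
    using Z X by (intro sum.cong refl) (simp add: rdiag_mult_index mult_ac del: index_mult_mat(1))
  finally show ?thesis
    unfolding Z_def X_def .
qed

section \<open>The two bounds for arbitrary pairs of eigenbases\<close>

lemma fidelity_le_desc_desc:
  assumes P: "unitary_mat n P" and Q: "unitary_mat n Q"
    and a: "\<And>i. i < n \<Longrightarrow> 0 \<le> a i" "\<And>i. Suc i < n \<Longrightarrow> a (Suc i) \<le> a i"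
    and b: "\<And>i. i < n \<Longrightarrow> 0 \<le> b i" "\<And>i. Suc i < n \<Longrightarrow> b (Suc i) \<le> b i"
  shows "fidelity (P * rdiag n a * mat_adjoint P) (Q * rdiag n b * mat_adjoint Q)
    \<le> (\<Sum>i<n. sqrt (a i * b i))"
proof -
  note Pc = unitary_matD[OF P] and Qc = unitary_matD[OF Q]
  define A where "A = P * rdiag n (\<lambda>i. sqrt (a i)) * mat_adjoint P"
  define B where "B = Q * rdiag n (\<lambda>i. sqrt (b i)) * mat_adjoint Q"
  let ?F = "fidelity (P * rdiag n a * mat_adjoint P) (Q * rdiag n b * mat_adjoint Q)"
  obtain R m where R: "unitary_mat n R" and m: "\<forall>i<n. 0 \<le> m i"
    and gram: "mat_adjoint (B * A * R) * (B * A * R) = rdiag n m"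
    and F: "?F = (\<Sum>i<n. sqrt (m i))"
    using fidelity_singular_values[where a = a and b = b, OF P Q a(1) b(1)] unfolding A_def B_def by blast
  have BA: "B * A \<in> carrier_mat n n"
    using Pc(1) Qc(1) by (auto simp: A_def B_def)
  obtain V where V: "V \<in> carrier_mat n n" and iso: "V * mat_adjoint V * V = V"
    and tr: "mat_trace (V * (B * A)) = complex_of_real (\<Sum>k<n. sqrt (m k))"
    using singular_values_eq_trace[OF BA R _ gram] m by blast
  define Z X where "Z = mat_adjoint P * V * Q" and "X = mat_adjoint Q * P"
  have Z: "Z \<in> carrier_mat n n"
    using V Pc(1) Qc(1) by (auto simp: Z_def)
  \<comment> \<open>Multiplying by unitaries on either side preserves partial isometries.\<close>
  have "Z * mat_adjoint Z * Z = mat_adjoint P * (V * mat_adjoint V * V) * Q"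
    using V Pc(1) Qc(1) by (simp add: Z_def mat_adjoint_mult[of _ n n _ n] assoc_mult_mat[of _ n n _ n _ n]
        mult_carrier_mat[of _ n n] unitary_mat_cancel[OF P] unitary_mat_cancel[OF Q])
  then have isoZ: "Z * mat_adjoint Z * Z = Z"
    unfolding iso Z_def .
  have X: "unitary_mat n X"
    unfolding X_def by (rule unitary_mat_mult[OF unitary_mat_adjoint[OF Q] P])
  \<comment> \<open>\<open>X\<close> enters transposed, so row sums of \<open>W\<close> use columns
    of \<open>X\<close> and column sums use rows.\<close>
  define W where "W i j = ((cmod (Z $$ (i, j)))\<^sup>2 + (cmod (X $$ (j, i)))\<^sup>2) / 2" for i j
  have "?F = Re (mat_trace (V * (B * A)))"
    by (simp add: F tr)
  also have "\<dots> = (\<Sum>i<n. \<Sum>j<n. Re (complex_of_real (sqrt (a i) * sqrt (b j)) * (Z $$ (i, j) * X $$ (j, i))))"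
    unfolding A_def B_def mat_trace_mult_conj_rdiag[OF V P Q] Z_def X_def by (simp only: Re_sum)
  also have "\<dots> \<le> (\<Sum>i<n. \<Sum>j<n. W i j * (sqrt (a i) * sqrt (b j)))"
  proof (intro sum_mono)
    fix i j assume "i \<in> {..<n}" "j \<in> {..<n}"
    then have ab: "0 \<le> sqrt (a i) * sqrt (b j)"
      using a b by simp
    have "Re (Z $$ (i, j) * X $$ (j, i)) \<le> cmod (Z $$ (i, j)) * cmod (X $$ (j, i))"
      by (metis complex_Re_le_cmod norm_mult)
    also have "\<dots> \<le> W i j"
      using sum_squares_bound[of "cmod (Z $$ (i, j))" "cmod (X $$ (j, i))"] by (simp add: W_def)
    finally have "(sqrt (a i) * sqrt (b j)) * Re (Z $$ (i, j) * X $$ (j, i)) \<le> (sqrt (a i) * sqrt (b j)) * W i j"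
      by (rule mult_left_mono[OF _ ab])
    then show "Re (complex_of_real (sqrt (a i) * sqrt (b j)) * (Z $$ (i, j) * X $$ (j, i)))
        \<le> W i j * (sqrt (a i) * sqrt (b j))"
      by (simp only: Re_complex_of_real Im_complex_of_real times_complex.sel mult.commute[of "W i j"])
  qed
  also have "\<dots> \<le> (\<Sum>i<n. sqrt (a i) * sqrt (b i))"
  proof (rule substochastic_rearrangement)
    fix i assume i: "i < n"
    show "(\<Sum>j<n. W i j) \<le> 1"
      using partial_isometry_row_le[OF Z isoZ i] unitary_mat_col[OF X i]
      by (simp add: W_def sum.distrib flip: sum_divide_distrib)
    show "(\<Sum>j<n. W j i) \<le> 1"
      using partial_isometry_col_le[OF Z isoZ i] unitary_mat_row[OF X i]
      by (simp add: W_def sum.distrib flip: sum_divide_distrib)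
  qed (use a b in \<open>auto simp: W_def\<close>)
  finally show ?thesis
    by (simp only: real_sqrt_mult)
qed

lemma fidelity_ge_desc_asc:
  assumes P: "unitary_mat n P" and Q: "unitary_mat n Q"
    and a: "\<And>i. i < n \<Longrightarrow> 0 \<le> a i" "\<And>i. Suc i < n \<Longrightarrow> a (Suc i) \<le> a i"
    and b: "\<And>i. i < n \<Longrightarrow> 0 \<le> b i" "\<And>i. Suc i < n \<Longrightarrow> b i \<le> b (Suc i)"
  shows "(\<Sum>i<n. sqrt (a i * b i))
    \<le> fidelity (P * rdiag n a * mat_adjoint P) (Q * rdiag n b * mat_adjoint Q)"
proof -
  note Pc = unitary_matD[OF P] and Qc = unitary_matD[OF Q]
  define A where "A = P * rdiag n (\<lambda>i. sqrt (a i)) * mat_adjoint P"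
  define B where "B = Q * rdiag n (\<lambda>i. sqrt (b i)) * mat_adjoint Q"
  let ?F = "fidelity (P * rdiag n a * mat_adjoint P) (Q * rdiag n b * mat_adjoint Q)"
  obtain R m where R: "unitary_mat n R"
    and gram: "mat_adjoint (B * A * R) * (B * A * R) = rdiag n m"
    and F: "?F = (\<Sum>i<n. sqrt (m i))"
    using fidelity_singular_values[where a = a and b = b, OF P Q a(1) b(1)] unfolding A_def B_def by blast
  have BA: "B * A \<in> carrier_mat n n"
    using Pc(1) Qc(1) by (auto simp: A_def B_def)
  define X where "X = mat_adjoint Q * P"
  have X: "unitary_mat n X"
    unfolding X_def by (rule unitary_mat_mult[OF unitary_mat_adjoint[OF Q] P])
  \<comment> \<open>With the identity in place of the partial isometry, Z is the adjoint of
    \<open>X\<close>, and the products of entries become the squared moduli of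
    \<open>X\<close>.\<close>
  have Z: "mat_adjoint P * 1\<^sub>m n * Q = mat_adjoint X"
    using Pc(1) Qc(1) by (simp add: X_def mat_adjoint_mult[of _ n n _ n] right_mult_one_mat[of _ n n])
  have "(\<Sum>i<n. sqrt (a i) * sqrt (b i)) \<le> (\<Sum>i<n. \<Sum>j<n. (cmod (X $$ (j, i)))\<^sup>2 * (sqrt (a i) * sqrt (b j)))"
    by (rule doubly_stochastic_rearrangement) (use a b unitary_mat_row[OF X] unitary_mat_col[OF X] in auto)
  also have "\<dots> = (\<Sum>i<n. \<Sum>j<n. Re (complex_of_real (sqrt (a i) * sqrt (b j))
      * (mat_adjoint X $$ (i, j) * X $$ (j, i))))"
  proof (intro sum.cong refl)
    fix i j assume "i \<in> {..<n}" "j \<in> {..<n}"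
    then have "mat_adjoint X $$ (i, j) * X $$ (j, i) = complex_of_real ((cmod (X $$ (j, i)))\<^sup>2)"
      using unitary_matD(1)[OF X] by (simp add: complex_norm_square mult.commute del: of_real_power)
    then show "(cmod (X $$ (j, i)))\<^sup>2 * (sqrt (a i) * sqrt (b j))
        = Re (complex_of_real (sqrt (a i) * sqrt (b j)) * (mat_adjoint X $$ (i, j) * X $$ (j, i)))"
      by (simp only: Re_complex_of_real flip: of_real_mult) (simp only: mult.commute)
  qed
  also have "\<dots> = Re (mat_trace (1\<^sub>m n * (B * A)))"
    unfolding A_def B_def mat_trace_mult_conj_rdiag[OF one_carrier_mat P Q] Z X_def[symmetric]
    by (simp only: Re_sum)
  also have "\<dots> = Re (mat_trace (B * A))"
    unfolding left_mult_one_mat[OF BA] ..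
  also have "\<dots> \<le> ?F"
    unfolding F by (rule Re_mat_trace_le_singular_values[OF BA R gram])
  finally show ?thesis
    by (simp only: real_sqrt_mult)
qed

section \<open>Attaining the bounds\<close>

lemma fidelity_simultaneously_diagonal:
  assumes P: "unitary_mat n P"
    and a: "\<And>i. i < n \<Longrightarrow> 0 \<le> a i" and b: "\<And>i. i < n \<Longrightarrow> 0 \<le> b i"
  shows "fidelity (P * rdiag n a * mat_adjoint P) (P * rdiag n b * mat_adjoint P) = (\<Sum>i<n. sqrt (a i * b i))"
proof -
  have "rdiag n (\<lambda>i. sqrt (a i) * b i * sqrt (a i)) = rdiag n (\<lambda>i. a i * b i)"
    using a by (intro rdiag_cong) (simp add: mult.commute mult.left_commute)
  then show ?thesis
    using a b by (simp add: fidelity_def mat_sqrt_conj_rdiag[OF P] conj_rdiag_mult[OF P] mat_trace_conj_rdiag[OF P])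
qed

text \<open>Conjugation by \<open>U\<close> only changes the eigenbasis from \<open>Q\<close> to
  \<open>U * Q\<close>, so bounds valid for all eigenbases cover every \<open>U\<close>.\<close>

lemma conj_conj_rdiag:
  assumes U: "unitary_mat n U" and Q: "unitary_mat n Q"
  shows "U * (Q * rdiag n f * mat_adjoint Q) * mat_adjoint U = (U * Q) * rdiag n f * mat_adjoint (U * Q)"
  using unitary_matD(1)[OF U] unitary_matD(1)[OF Q]
  by (simp add: mat_adjoint_mult[of _ n n _ n] assoc_mult_mat[of _ n n _ n _ n] mult_carrier_mat[of _ n n])

lemma fidelity_attained:
  assumes P: "unitary_mat n P" and Q: "unitary_mat n Q"
    and a: "\<And>i. i < n \<Longrightarrow> 0 \<le> a i" and b: "\<And>i. i < n \<Longrightarrow> 0 \<le> b i"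
  shows "\<exists>U. unitary_mat n U \<and> (\<Sum>i<n. sqrt (a i * b i))
    = fidelity (P * rdiag n a * mat_adjoint P) (U * (Q * rdiag n b * mat_adjoint Q) * mat_adjoint U)"
proof (intro exI conjI)
  note Pc = unitary_matD[OF P] and Qc = unitary_matD[OF Q]
  \<comment> \<open>This unitary carries each column of \<open>Q\<close> to the corresponding column
    of \<open>P\<close>.\<close>
  show U: "unitary_mat n (P * mat_adjoint Q)"
    by (rule unitary_mat_mult[OF P unitary_mat_adjoint[OF Q]])
  have "P * mat_adjoint Q * Q = P"
    using Pc(1) Qc by (simp add: assoc_mult_mat[of _ n n _ n _ n] right_mult_one_mat[of _ n n])
  then show "(\<Sum>i<n. sqrt (a i * b i)) = fidelity (P * rdiag n a * mat_adjoint P)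
      ((P * mat_adjoint Q) * (Q * rdiag n b * mat_adjoint Q) * mat_adjoint (P * mat_adjoint Q))"
    by (simp only: conj_conj_rdiag[OF U Q] fidelity_simultaneously_diagonal[OF P a b])
qed

theorem theorem1:
  fixes d :: nat and \<rho> \<sigma> :: "complex mat"
  assumes "d \<ge> 1"
    and "density_mat d \<rho>" and "density_mat d \<sigma>"
  shows "classical_fidelity (eig_desc \<rho>) (eig_desc \<sigma>)
            \<in> {fidelity \<rho> (U * \<sigma> * mat_adjoint U) | U. unitary_mat d U}
       \<and> (\<forall>U. unitary_mat d U \<longrightarrow>
            fidelity \<rho> (U * \<sigma> * mat_adjoint U) \<le> classical_fidelity (eig_desc \<rho>) (eig_desc \<sigma>))
       \<and> classical_fidelity (eig_desc \<rho>) (eig_desc \<sigma>)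
            = (\<Sum>j<d. sqrt (eig_desc \<rho> ! j * eig_desc \<sigma> ! j))
       \<and> classical_fidelity (eig_desc \<rho>) (eig_asc \<sigma>)
            \<in> {fidelity \<rho> (U * \<sigma> * mat_adjoint U) | U. unitary_mat d U}
       \<and> (\<forall>U. unitary_mat d U \<longrightarrow>
            classical_fidelity (eig_desc \<rho>) (eig_asc \<sigma>) \<le> fidelity \<rho> (U * \<sigma> * mat_adjoint U))
       \<and> classical_fidelity (eig_desc \<rho>) (eig_asc \<sigma>)
            = (\<Sum>j<d. sqrt (eig_desc \<rho> ! j * eig_asc \<sigma> ! j))"
proof -
  have psd: "psd_mat d \<rho>" "psd_mat d \<sigma>"
    using assms by (auto simp: density_mat_def)
  then have herm: "hermitian_mat d \<rho>" "hermitian_mat d \<sigma>"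
    by (auto simp: psd_mat_def)
  note eig = eig_desc_props[OF herm(1)] eig_desc_props[OF herm(2)]
  let ?a = "\<lambda>i. eig_desc \<rho> ! i" and ?b = "\<lambda>i. eig_desc \<sigma> ! i" and ?c = "\<lambda>i. eig_asc \<sigma> ! i"
  have asc: "mset (eig_asc \<sigma>) = mset (eig_desc \<sigma>)" "length (eig_asc \<sigma>) = d" "sorted_wrt (\<le>) (eig_asc \<sigma>)"
    using eig(4,5) by (simp_all add: eig_asc_def sorted_wrt_rev)
  have a: "0 \<le> ?a i" if "i < d" for i
    using psd_mat_eig_nonneg[OF psd(1)] eig(1) that by simp
  have b: "0 \<le> ?b i" if "i < d" for i
    using psd_mat_eig_nonneg[OF psd(2)] eig(4) that by simp
  have c: "0 \<le> ?c i" if "i < d" for i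
    using psd_mat_eig_nonneg[OF psd(2), of "?c i"] asc(2) that
    by (metis asc(1) mset_eq_setD nth_mem)
  have a_desc: "?a (Suc i) \<le> ?a i" if "Suc i < d" for i
    using sorted_wrt_nth_less[OF eig(2), of i "Suc i"] eig(1) that by simp
  have b_desc: "?b (Suc i) \<le> ?b i" if "Suc i < d" for i
    using sorted_wrt_nth_less[OF eig(5), of i "Suc i"] eig(4) that by simp
  have c_asc: "?c i \<le> ?c (Suc i)" if "Suc i < d" for i
    using sorted_wrt_nth_less[OF asc(3), of i "Suc i"] asc(2) that by simp
  obtain P where P: "unitary_mat d P" and \<rho>: "\<rho> = P * rdiag d ?a * mat_adjoint P"
    using hermitian_mat_spectral[OF herm(1) refl] by blast
  obtain Q where Q: "unitary_mat d Q" and \<sigma>: "\<sigma> = Q * rdiag d ?b * mat_adjoint Q"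
    using hermitian_mat_spectral[OF herm(2) refl] by blast
  \<comment> \<open>A second diagonalisation of \<open>\<sigma>\<close>, with increasing
    eigenvalues, so that the minimum needs no permutation matrices.\<close>
  obtain S where S: "unitary_mat d S" and \<sigma>': "\<sigma> = S * rdiag d ?c * mat_adjoint S"
    using hermitian_mat_spectral[OF herm(2) asc(1)] by blast
  have cf: "classical_fidelity (eig_desc \<rho>) (eig_desc \<sigma>) = (\<Sum>j<d. sqrt (?a j * ?b j))"
    "classical_fidelity (eig_desc \<rho>) (eig_asc \<sigma>) = (\<Sum>j<d. sqrt (?a j * ?c j))"
    by (simp_all add: classical_fidelity_def eig(1))
  have max_attained: "\<exists>U. unitary_mat d U \<and> (\<Sum>j<d. sqrt (?a j * ?b j)) = fidelity \<rho> (U * \<sigma> * mat_adjoint U)"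
    using fidelity_attained[where a = ?a and b = ?b, OF P Q a b] unfolding \<rho>[symmetric] \<sigma>[symmetric] .
  have min_attained: "\<exists>U. unitary_mat d U \<and> (\<Sum>j<d. sqrt (?a j * ?c j)) = fidelity \<rho> (U * \<sigma> * mat_adjoint U)"
    using fidelity_attained[where a = ?a and b = ?c, OF P S a c] unfolding \<rho>[symmetric] \<sigma>'[symmetric] .
  have upper: "fidelity \<rho> (U * \<sigma> * mat_adjoint U) \<le> (\<Sum>j<d. sqrt (?a j * ?b j))" if U: "unitary_mat d U" for U
    using fidelity_le_desc_desc[where a = ?a and b = ?b, OF P unitary_mat_mult[OF U Q] a a_desc b b_desc]
    unfolding conj_conj_rdiag[OF U Q, symmetric] \<rho>[symmetric] \<sigma>[symmetric] .
  have lower: "(\<Sum>j<d. sqrt (?a j * ?c j)) \<le> fidelity \<rho> (U * \<sigma> * mat_adjoint U)" if U: "unitary_mat d U" for U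
    using fidelity_ge_desc_asc[where a = ?a and b = ?c, OF P unitary_mat_mult[OF U S] a a_desc c c_asc]
    unfolding conj_conj_rdiag[OF U S, symmetric] \<rho>[symmetric] \<sigma>'[symmetric] .
  show ?thesis
    unfolding cf using max_attained min_attained upper lower by blast
qed

end
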